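(* Let $n\ge1$ be an integer and let $L>0$. For any finite collection of persistence diagrams $p_1,p_2,\dots,p_k\in\mathcal D_n$ there exist uncountably many pairwise different persistence diagrams $a_t\in\mathcal D_n\cap[0,L]^2$, $t\in\mathbb R$, such that for each $j\in\{1,\dots,k\}$ the distance $d_{\mathcal B}(a_t,p_j)$ is independent of $t$.
   Context: $\mathcal D_1=T\cup\{\Delta\}$, where $T=\{(x_1,x_2)\in\mathbb R^2: x_2>x_1\ge0\}$ and $\Delta$ is one extra point. The metric $d_{\mathcal B}$ on $\mathcal D_1$ is given by $d_{\mathcal B}(\Delta,\Delta)=0$, $d_{\mathcal B}((x_1,x_2),\Delta)=|x_1-x_2|/2$, and $$d_{\mathcal B}((x_1,x_2),(y_1,y_2))=\min\Big\{\max\{|x_1-y_1|,|x_2-y_2|\},\ \max\{d_{\mathcal B}((x_1,x_2),\Delta),d_{\mathcal B}((y_1,y_2),\Delta)\}\Big\}.$$ $\mathcal D_n=\mathcal D_1^n/S_n$ is the set of unordered $n$-tuples (multisets) $[\bar x_1,\dots,\bar x_n]$ of points of $\mathcal D_1$, with the bottleneck metric $d_{\mathcal B}([\bar x_i],[\bar y_i])=\min_{\psi\in S_n}\max_i d_{\mathcal B}(\bar x_i,\bar y_{\psi(i)})$. $\mathcal D_n\cap[0,L]^2$ denotes the subspace of those diagrams in $\mathcal D_n$ each of whose points is either $\Delta$ or lies in $T\cap[0,L]^2$. *)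

theory Defs
  imports Complex_Main "HOL-Library.Multiset" "HOL-Combinatorics.List_Permutation"
begin

definition upper_wedge :: "(real \<times> real) set" where
  "upper_wedge = {(x1, x2). x2 > x1 \<and> x1 \<ge> 0}"

text \<open>The type also contains values \<open>Off x\<close> with \<open>x\<close> outside \<open>upper_wedge\<close>;
  the space itself is the set \<open>diagram_points\<close>.\<close>

datatype dpoint = Diag | Off "real \<times> real"

definition diagram_points :: "dpoint set" where
  "diagram_points = insert Diag (Off ` upper_wedge)"

fun dist_to_Diag :: "dpoint \<Rightarrow> real" where
  "dist_to_Diag Diag = 0"
| "dist_to_Diag (Off (x1, x2)) = \<bar>x1 - x2\<bar> / 2"

fun point_dist :: "dpoint \<Rightarrow> dpoint \<Rightarrow> real" where
  "point_dist p Diag = dist_to_Diag p"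
| "point_dist Diag q = dist_to_Diag q"
| "point_dist (Off (x1, x2)) (Off (y1, y2)) =
     min (max \<bar>x1 - y1\<bar> \<bar>x2 - y2\<bar>)
         (max (dist_to_Diag (Off (x1, x2))) (dist_to_Diag (Off (y1, y2))))"

text \<open>Unordered \<open>n\<close>-tuples are multisets of size \<open>n\<close>; \<open>Diag\<close> counts towards the size.\<close>

definition diagrams :: "nat \<Rightarrow> dpoint multiset set" where
  "diagrams n = {M. size M = n \<and> set_mset M \<subseteq> diagram_points}"

definition diagrams_in_square :: "nat \<Rightarrow> real \<Rightarrow> dpoint multiset set" where
  "diagrams_in_square n L =
     {M \<in> diagrams n. set_mset M \<subseteq> insert Diag (Off ` (upper_wedge \<inter> {0..L} \<times> {0..L}))}"

text \<open>Meaningful for nonempty lists of equal length only.\<close>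

definition tuple_dist :: "dpoint list \<Rightarrow> dpoint list \<Rightarrow> real" where
  "tuple_dist xs ys =
     (MIN \<psi>\<in>{\<psi>. \<psi> permutes {..<length xs}}.
        MAX i\<in>{..<length xs}. point_dist (xs ! i) (ys ! \<psi> i))"

text \<open>The choice of representatives is immaterial: see \<open>bottleneck_dist_mset\<close> below.\<close>

definition bottleneck_dist :: "dpoint multiset \<Rightarrow> dpoint multiset \<Rightarrow> real" where
  "bottleneck_dist M N = tuple_dist (SOME xs. mset xs = M) (SOME ys. mset ys = N)"

lemma tuple_dist_permute_left:
  assumes "length xs = length ys" and p: "p permutes {..<length xs}"
  shows "tuple_dist (permute_list p xs) ys = tuple_dist xs ys"
proof -
  let ?I = "{..<length xs}"
  let ?P = "{\<psi>. \<psi> permutes ?I}"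
  have "(\<lambda>i. point_dist (permute_list p xs ! i) (ys ! \<psi> i)) ` ?I
      = (\<lambda>i. point_dist (xs ! i) (ys ! (\<psi> \<circ> inv p) i)) ` ?I" for \<psi>
  proof -
    have "(\<lambda>i. point_dist (xs ! i) (ys ! (\<psi> \<circ> inv p) i)) ` ?I
        = (\<lambda>i. point_dist (xs ! i) (ys ! (\<psi> \<circ> inv p) i)) ` p ` ?I"
      using permutes_image[OF p] by simp
    also have "\<dots> = (\<lambda>i. point_dist (permute_list p xs ! i) (ys ! \<psi> i)) ` ?I"
      unfolding image_image
      by (intro image_cong refl) (simp add: permute_list_nth[OF p] permutes_inverses[OF p])
    finally show ?thesis by simp
  qed
  then have "tuple_dist (permute_list p xs) ys
      = Min ((\<lambda>\<psi>. MAX i\<in>?I. point_dist (xs ! i) (ys ! \<psi> i)) ` (\<lambda>\<psi>. \<psi> \<circ> inv p) ` ?P)"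
    by (simp add: tuple_dist_def image_image)
  also have "(\<lambda>\<psi>. \<psi> \<circ> inv p) ` ?P = ?P"
  proof (intro equalityI subsetI)
    fix \<psi> assume "\<psi> \<in> ?P"
    then have "\<psi> \<circ> p \<in> ?P" using permutes_compose[OF p] by simp
    moreover have "\<psi> = (\<psi> \<circ> p) \<circ> inv p"
      by (simp add: fun_eq_iff permutes_inverses[OF p])
    ultimately show "\<psi> \<in> (\<lambda>\<psi>. \<psi> \<circ> inv p) ` ?P" by blast
  qed (use permutes_compose[OF permutes_inv[OF p]] in auto)
  finally show ?thesis by (simp add: tuple_dist_def)
qed

lemma tuple_dist_permute_right:
  assumes len: "length xs = length ys" and p: "p permutes {..<length ys}"
  shows "tuple_dist xs (permute_list p ys) = tuple_dist xs ys"
proof -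
  let ?I = "{..<length ys}"
  let ?P = "{\<psi>. \<psi> permutes ?I}"
  have "(\<lambda>i. point_dist (xs ! i) (permute_list p ys ! \<psi> i)) ` ?I
      = (\<lambda>i. point_dist (xs ! i) (ys ! (p \<circ> \<psi>) i)) ` ?I" if "\<psi> \<in> ?P" for \<psi>
  proof (intro image_cong refl)
    fix i assume "i \<in> ?I"
    then have "\<psi> i < length ys" using that permutes_in_image[of \<psi> ?I i] by simp
    then show "point_dist (xs ! i) (permute_list p ys ! \<psi> i)
        = point_dist (xs ! i) (ys ! (p \<circ> \<psi>) i)"
      by (simp add: permute_list_nth[OF p])
  qed
  then have "tuple_dist xs (permute_list p ys)
      = Min ((\<lambda>\<psi>. MAX i\<in>?I. point_dist (xs ! i) (ys ! \<psi> i)) ` (\<lambda>\<psi>. p \<circ> \<psi>) ` ?P)"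
    unfolding tuple_dist_def len image_image by (intro arg_cong[of _ _ Min] image_cong refl) simp
  also have "(\<lambda>\<psi>. p \<circ> \<psi>) ` ?P = ?P"
  proof (intro equalityI subsetI)
    fix \<psi> assume "\<psi> \<in> ?P"
    then have "inv p \<circ> \<psi> \<in> ?P" using permutes_compose[OF _ permutes_inv[OF p]] by simp
    moreover have "\<psi> = p \<circ> (inv p \<circ> \<psi>)"
      by (simp add: fun_eq_iff permutes_inverses[OF p])
    ultimately show "\<psi> \<in> (\<lambda>\<psi>. p \<circ> \<psi>) ` ?P" by blast
  qed (use permutes_compose[OF _ p] in auto)
  finally show ?thesis by (simp add: tuple_dist_def len)
qed

lemma bottleneck_dist_mset:
  assumes len: "length xs = length ys"
  shows "bottleneck_dist (mset xs) (mset ys) = tuple_dist xs ys"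
proof -
  define xs' where "xs' = (SOME zs. mset zs = mset xs)"
  define ys' where "ys' = (SOME zs. mset zs = mset ys)"
  have mx: "mset xs' = mset xs" unfolding xs'_def by (rule someI[of _ xs]) simp
  have my: "mset ys' = mset ys" unfolding ys'_def by (rule someI[of _ ys]) simp
  obtain p where p: "p permutes {..<length xs}" "permute_list p xs = xs'"
    using mset_eq_permutation[OF mx] by blast
  obtain q where q: "q permutes {..<length ys}" "permute_list q ys = ys'"
    using mset_eq_permutation[OF my] by blast
  have "length xs = length ys'" using len mset_eq_length[OF my] by simp
  then have "tuple_dist xs' ys' = tuple_dist xs ys"
    using tuple_dist_permute_left[OF _ p(1), of ys'] tuple_dist_permute_right[OF len q(1)] p(2) q(2)
    by simp
  then show ?thesis by (simp add: bottleneck_dist_def xs'_def ys'_def)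
qed

end

theory Submission
  imports Defs
begin

text \<open>
  The distances from \<open>p\<^sub>j\<close> cannot detect where a point of very small persistence sits near the
  origin. Write \<open>h\<close> for the distance of \<open>(u, u + 2h)\<close> from the diagonal, and let \<open>(c, d)\<close> be an
  off-diagonal point of some \<open>p\<^sub>j\<close>. Leaving \<open>(c, d)\<close> unmatched costs \<open>(d - c)/2\<close>; matching
  it with \<open>(u, u + 2h)\<close> is cheaper only if \<open>(u, u + 2h)\<close> lies within sup-distance \<open>(d - c)/2\<close> of
  \<open>(c, d)\<close>, and hence only if its second coordinate exceeds \<open>(c + d)/2\<close>. Since \<open>c \<ge> 0\<close>, this is
  impossible as soon as \<open>u + 2h \<le> (d - c)/2\<close> (lemma \<open>point_dist_near_origin\<close>).

  The \<open>p\<^sub>j\<close> have finitely many points altogether, so their positive persistences have a positive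
  lower bound. For a suitable fixed \<open>h\<close> and all \<open>u\<close> in a short interval starting at \<open>0\<close>, the
  point \<open>(u, u + 2h)\<close> therefore has the same distance to each point of each \<open>p\<^sub>j\<close>: the distance
  to \<open>\<Delta>\<close> is \<open>h\<close>, and the distance to any other point is the persistence of that point. The
  diagrams \<open>[(u, u + 2h), \<Delta>, \<dots>, \<Delta>]\<close> then have equal bottleneck distances to each \<open>p\<^sub>j\<close>
  (lemma \<open>bottleneck_dist_replace_point\<close>), because every matching has the same cost for all \<open>u\<close>.
\<close>

lemma dist_to_Diag_pos: "y \<in> upper_wedge \<Longrightarrow> dist_to_Diag (Off y) > 0"
  by (auto simp: upper_wedge_def)

text \<open>
  For \<open>y = (c, d)\<close> the second coordinates differ by at least \<open>d - (d - c)/2 = (c + d)/2\<close>, which is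
  at least the persistence \<open>(d - c)/2\<close> of \<open>y\<close> because \<open>c \<ge> 0\<close>; so the minimum defining the metric
  is attained by the cost of sending both points to the diagonal.
\<close>

lemma point_dist_near_origin:
  assumes "y \<in> upper_wedge" "u \<ge> 0" "h \<ge> 0" "u + 2 * h \<le> dist_to_Diag (Off y)"
  shows "point_dist (Off (u, u + 2 * h)) (Off y) = dist_to_Diag (Off y)"
proof -
  obtain c d where y: "y = (c, d)" by fastforce
  have cd: "c \<ge> 0" "c < d" using assms(1) by (auto simp: y upper_wedge_def)
  have le: "u + 2 * h \<le> (d - c) / 2" using assms(4) cd by (simp add: y)
  have "(d - c) / 2 \<le> d - (u + 2 * h)" using le cd by (simp add: field_simps)
  then have "(d - c) / 2 \<le> \<bar>(u + 2 * h) - d\<bar>" by linarith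
  moreover have "h \<le> (d - c) / 2" using le assms(2,3) by linarith
  moreover have "dist_to_Diag (Off (c, d)) = (d - c) / 2" using cd by simp
  moreover have "dist_to_Diag (Off (u, u + 2 * h)) = h" using assms(3) by simp
  ultimately show ?thesis
    unfolding y point_dist.simps by linarith
qed

lemma tuple_dist_cong:
  assumes len: "length xs = length xs'" "length xs = length ys"
    and eq: "\<And>i j. i < length xs \<Longrightarrow> j < length xs \<Longrightarrow>
               point_dist (xs ! i) (ys ! j) = point_dist (xs' ! i) (ys ! j)"
  shows "tuple_dist xs ys = tuple_dist xs' ys"
proof -
  have "point_dist (xs ! i) (ys ! \<psi> i) = point_dist (xs' ! i) (ys ! \<psi> i)"
    if "\<psi> permutes {..<length xs}" "i \<in> {..<length xs}" for \<psi> i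
    using that eq permutes_in_image[OF that(1), of i] by auto
  then show ?thesis
    unfolding tuple_dist_def len(1)[symmetric]
    by (intro arg_cong[of _ _ Min] arg_cong[of _ _ Max] image_cong refl) auto
qed

lemma bottleneck_dist_replace_point:
  assumes size: "size P = Suc (size N)"
    and eq: "\<And>q. q \<in># P \<Longrightarrow> point_dist x q = point_dist x' q"
  shows "bottleneck_dist (add_mset x N) P = bottleneck_dist (add_mset x' N) P"
proof -
  obtain zs where zs: "mset zs = N" using ex_mset by blast
  obtain ys where ys: "mset ys = P" using ex_mset by blast
  have len: "length ys = Suc (length zs)" using size by (simp flip: zs ys)
  have "tuple_dist (x # zs) ys = tuple_dist (x' # zs) ys"
  proof (rule tuple_dist_cong)
    fix i j assume "i < length (x # zs)" "j < length (x # zs)"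
    then have "ys ! j \<in># P" using len by (simp flip: ys)
    then show "point_dist ((x # zs) ! i) (ys ! j) = point_dist ((x' # zs) ! i) (ys ! j)"
      using eq by (cases i) auto
  qed (use len in auto)
  then show ?thesis
    using bottleneck_dist_mset[of "x # zs" ys] bottleneck_dist_mset[of "x' # zs" ys] len
    by (simp add: zs ys)
qed

lemma ex_inj_real_into_interval:
  fixes e :: real
  assumes "e > 0"
  shows "\<exists>u :: real \<Rightarrow> real. inj u \<and> (\<forall>t. 0 < u t \<and> u t < e)"
proof (intro exI conjI allI)
  let ?u = "\<lambda>t. e * (arctan t / pi + 1 / 2)"
  show "inj ?u" using assms by (auto intro!: injI simp: arctan_eq_iff)
  fix t :: real
  have lower: "0 < arctan t / pi + 1 / 2" and upper: "arctan t / pi + 1 / 2 < 1"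
    using arctan_bounded[of t] by (auto simp: field_simps)
  show "0 < ?u t" using assms lower by (rule mult_pos_pos)
  show "?u t < e" using mult_strict_left_mono[OF upper assms] by simp
qed

theorem proposition5p3:
  fixes n k :: nat and L :: real and p :: "nat \<Rightarrow> dpoint multiset"
  assumes "n \<ge> 1" and "L > 0"
    and "\<And>j. j \<in> {1..k} \<Longrightarrow> p j \<in> diagrams n"
  shows "\<exists>a :: real \<Rightarrow> dpoint multiset.
           inj a \<and>
           (\<forall>t. a t \<in> diagrams_in_square n L) \<and>
           (\<forall>j\<in>{1..k}. \<forall>s t. bottleneck_dist (a s) (p j) = bottleneck_dist (a t) (p j))"
proof -
  define Q where "Q = (\<Union>j\<in>{1..k}. set_mset (p j)) - {Diag}"
  define e where "e = Min (insert L (dist_to_Diag ` Q))"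
  have fin: "finite Q" by (auto simp: Q_def)
  have Q: "\<exists>y. q = Off y \<and> y \<in> upper_wedge" if "q \<in> Q" for q
    using that assms(3) by (fastforce simp: Q_def diagrams_def diagram_points_def)
  have e_pos: "e > 0"
    unfolding e_def using fin Q dist_to_Diag_pos assms(2) by (subst Min_gr_iff) auto
  have e_L: "e \<le> L" unfolding e_def using fin by (intro Min_le) auto
  have e_Q: "e \<le> dist_to_Diag q" if "q \<in> Q" for q
    unfolding e_def using fin that by (intro Min_le) auto
  \<comment> \<open>With \<open>u < e / 4\<close> and \<open>h = e / 4\<close>, the larger coordinate \<open>u + 2h\<close> stays below \<open>e\<close>.\<close>
  define h where "h = e / 4"
  obtain u :: "real \<Rightarrow> real" where "inj u" and u: "\<And>t. 0 < u t" "\<And>t. u t < e / 4"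
    using ex_inj_real_into_interval[of "e / 4"] e_pos by auto
  have h: "h > 0" and uh: "u t + 2 * h < e" for t
    using e_pos u(2)[of t] by (simp_all add: h_def)
  define x where "x t = Off (u t, u t + 2 * h)" for t
  define a where "a t = add_mset (x t) (replicate_mset (n - 1) Diag)" for t
  have "inj a" using \<open>inj u\<close> by (auto simp: inj_def a_def x_def)
  moreover have "a t \<in> diagrams_in_square n L" for t
    using u(1)[of t] h uh[of t] e_L assms(1)
    by (auto simp: diagrams_in_square_def diagrams_def diagram_points_def upper_wedge_def
        a_def x_def split: if_splits)
  moreover have "bottleneck_dist (a s) (p j) = bottleneck_dist (a t) (p j)"
    if j: "j \<in> {1..k}" for j s t
    unfolding a_def
  proof (rule bottleneck_dist_replace_point)
    show "size (p j) = Suc (size (replicate_mset (n - 1) Diag))"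
      using assms(1) assms(3)[OF j] by (simp add: diagrams_def)
    fix q assume q: "q \<in># p j"
    show "point_dist (x s) q = point_dist (x t) q"
    proof (cases "q = Diag")
      case True
      then show ?thesis by (simp add: x_def)
    next
      case False
      then have "q \<in> Q" using q j by (auto simp: Q_def)
      then obtain y where y: "q = Off y" "y \<in> upper_wedge" using Q by blast
      have "point_dist (x r) q = dist_to_Diag q" for r
        unfolding x_def y(1)
        using u(1)[of r] h uh[of r] e_Q[OF \<open>q \<in> Q\<close>] y
        by (intro point_dist_near_origin) auto
      then show ?thesis by simp
    qed
  qed
  ultimately show ?thesis by blast
qed

end
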